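(* For every integer $n\geq 1$, $$F_{n}(y,t)=\frac{1}{1+t}\left(B_{n}(y,t^{2})+\frac{1}{t}\sum_{k=0}^{n}(-1)^{n-k}\binom{n}{k}(1-t^{2})^{n-k}B_{k}(y,t^{2})\right).$$
   Context: $\mathfrak{B}_n$ is the set of signed permutations: permutations $\pi$ of $\{-n,\dots,-1,0,1,\dots,n\}$ with $\pi_{-i}=-\pi_i$ for all $i$ (so $\pi_0=0$), written $\pi=\pi_1\cdots\pi_n$. For $\pi\in\mathfrak{B}_n$: $\mathrm{des}_B(\pi)$ is the number of $i\in\{0,1,\dots,n-1\}$ with $\pi_i>\pi_{i+1}$ (where $\pi_0=0$); the flag descent number $\mathrm{fdes}(\pi)$ is $2\,\mathrm{des}_B(\pi)$ if $\pi_1>0$ and $2\,\mathrm{des}_B(\pi)-1$ if $\pi_1<0$; $\mathrm{neg}(\pi)$ is the number of $i\in\{1,\dots,n\}$ with $\pi_i<0$. For $n\ge1$, $B_n(y,t)=\sum_{\pi\in\mathfrak{B}_n}y^{\mathrm{neg}(\pi)}t^{\mathrm{des}_B(\pi)}$ and $F_n(y,t)=\sum_{\pi\in\mathfrak{B}_n}y^{\mathrm{neg}(\pi)}t^{\mathrm{fdes}(\pi)}$; also $B_0(y,t)=1$. The identity is one of rational functions in the indeterminates $y,t$. *)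

theory Defs
  imports "HOL-Computational_Algebra.Computational_Algebra"
    "HOL-Combinatorics.Permutations"
begin

definition signed_perms :: "nat \<Rightarrow> (int \<Rightarrow> int) set" where
  "signed_perms n =
     {\<pi>. \<pi> permutes {- int n..int n} \<and> (\<forall>i\<in>{- int n..int n}. \<pi> (- i) = - \<pi> i)}"

definition desB :: "nat \<Rightarrow> (int \<Rightarrow> int) \<Rightarrow> nat" where
  "desB n \<pi> = card {i \<in> {0..<int n}. \<pi> i > \<pi> (i + 1)}"

(* For n >= 1, pi_1 is nonzero, and pi_1 < 0 makes the position 0 a descent, so desB n pi >= 1
   in the second branch and the natural-number subtraction does not truncate. *)
definition fdes :: "nat \<Rightarrow> (int \<Rightarrow> int) \<Rightarrow> nat" where
  "fdes n \<pi> = (if \<pi> 1 > 0 then 2 * desB n \<pi> else 2 * desB n \<pi> - 1)"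

definition neg :: "nat \<Rightarrow> (int \<Rightarrow> int) \<Rightarrow> nat" where
  "neg n \<pi> = card {i \<in> {1..int n}. \<pi> i < 0}"

(* B_n(y,t) and F_n(y,t) at arbitrary elements of a commutative semiring, so that B_n(y,t^2) is
   B_poly n y (t^2). The convention B_0 = 1 is an instance of the same formula (B_poly_0). *)
definition B_poly :: "nat \<Rightarrow> 'a::comm_semiring_1 \<Rightarrow> 'a \<Rightarrow> 'a" where
  "B_poly n y t = (\<Sum>\<pi>\<in>signed_perms n. y ^ neg n \<pi> * t ^ desB n \<pi>)"

definition F_poly :: "nat \<Rightarrow> 'a::comm_semiring_1 \<Rightarrow> 'a \<Rightarrow> 'a" where
  "F_poly n y t = (\<Sum>\<pi>\<in>signed_perms n. y ^ neg n \<pi> * t ^ fdes n \<pi>)"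

lemma B_poly_0: "B_poly 0 y t = 1"
proof -
  have "signed_perms 0 = {id}"
    by (auto simp: signed_perms_def)
  then show ?thesis
    by (simp add: B_poly_def neg_def desB_def)
qed

(* The field of rational functions Q(y,t), as the fraction field of Q[y][t]: the inner polynomial
   variable is y, the outer one is t. *)
type_synonym ratfun = "rat poly poly fract"

definition Y :: ratfun where "Y = to_fract [:[:0, 1:]:]"

definition T :: ratfun where "T = to_fract [:0, 1:]"

end

theory Submission
  imports Defs
begin

text \<open>
  Write $B_n = B_n^+ + B_n^-$ according to the sign of $\pi_1$. Then
  $F_n(y,t) = B_n^+(y,t^2) + t^{-1} B_n^-(y,t^2)$, so the claim amounts to
  $A_n = \sum_k (-1)^{n-k} \binom{n}{k} (1-s)^{n-k} B_k$ for $A_n = s B_n^+ + B_n^-$ and $n \ge 1$,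
  where $s = t^2$. In $A_n$ the position 0 always contributes one factor $s$, so $A_n$ is $s$ times the
  generating function of the descents at the positions $1, \dots, n-1$; put $A_0 = 1$.

  By binomial inversion it is enough that $B_n = \sum_m \binom{n}{m} (1-s)^m A_{n-m}$. Give every
  descent of $0\,\pi_1 \cdots \pi_n$ the weight $s$, and split the weight $1$ of every ascent into
  $1-s$ (marked) plus $s$ (unmarked). If $m$ is maximal such that the first $m$ positions are marked
  ascents, then $\pi_1 < \dots < \pi_m$ is an arbitrary $m$-subset of $\{1, \dots, n\}$ in increasing
  order, and the remaining letters form a signed word on the complement that is counted by $A_{n-m}$.
\<close>

subsection \<open>Words with signed letters\<close>

text \<open>The alphabet is kept general because deleting an initial segment from a signed word on
  1, ..., n leaves a signed word on the complement of the deleted letters.\<close>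

definition signed_words :: "int set \<Rightarrow> int list set" where
  "signed_words K = {w. distinct (map abs w) \<and> abs ` set w = K}"

text \<open>Only comparisons inside the list count; the convention pi_0 = 0 is supplied by
  prepending 0 explicitly.\<close>

fun descents :: "int list \<Rightarrow> nat" where
  "descents (x # y # w) = of_bool (x > y) + descents (y # w)"
| "descents w = 0"

definition negs :: "int list \<Rightarrow> nat" where
  "negs w = length (filter (\<lambda>x. x < 0) w)"

text \<open>The extra factor \<open>s\<close> is the weight of the position just before the first
  letter once it is known not to be a marked ascent: \<open>s\<close> for a descent and
  \<open>s\<close> for an unmarked ascent alike. The empty word has no such position, hence the
  value 1, which makes A_0 = 1.\<close>

definition tail_weight :: "'a::comm_semiring_1 \<Rightarrow> int list \<Rightarrow> 'a" where
  "tail_weight s w = (if w = [] then 1 else s * s ^ descents w)"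

definition A_poly :: "nat \<Rightarrow> 'a::comm_semiring_1 \<Rightarrow> 'a \<Rightarrow> 'a" where
  "A_poly n y s = (\<Sum>w\<in>signed_words {1..int n}. y ^ negs w * tail_weight s w)"

lemma length_signed_word: "w \<in> signed_words K \<Longrightarrow> length w = card K"
  using distinct_card[of "map abs w"] by (auto simp: signed_words_def)

lemma finite_signed_words:
  assumes "finite K"
  shows "finite (signed_words K)"
proof (rule finite_subset)
  show "signed_words K \<subseteq> {w. set w \<subseteq> K \<union> uminus ` K \<and> length w = card K}"
  proof
    fix w assume w: "w \<in> signed_words K"
    have "x \<in> K \<union> uminus ` K" if "x \<in> set w" for x
    proof -
      have "\<bar>x\<bar> \<in> K" using w that by (auto simp: signed_words_def)
      then show ?thesis by (cases "x \<ge> 0") (auto intro: image_eqI[of _ _ "-x"])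
    qed
    then show "w \<in> {w. set w \<subseteq> K \<union> uminus ` K \<and> length w = card K}"
      using w length_signed_word by auto
  qed
  show "finite {w. set w \<subseteq> K \<union> uminus ` K \<and> length w = card K}"
    using assms by (intro finite_lists_length_eq) auto
qed

lemma descents_map:
  assumes "\<And>x y. x \<in> set w \<Longrightarrow> y \<in> set w \<Longrightarrow> g x < g y \<longleftrightarrow> x < y"
  shows "descents (map g w) = descents w"
  using assms by (induction w rule: descents.induct) auto

lemma negs_map:
  assumes "\<And>x. x \<in> set w \<Longrightarrow> g x < 0 \<longleftrightarrow> x < 0"
  shows "negs (map g w) = negs w"
  using assms by (induction w) (auto simp: negs_def)

lemma descents_map_upto:
  "descents (map f [a..b]) = card {i \<in> {a..<b}. f i > f (i + 1)}"
proof (induction "nat (b - a)" arbitrary: a)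
  \<comment> \<open>This case covers both the one-letter list \<open>a = b\<close> and the empty
    list \<open>b < a\<close>.\<close>
  case 0
  then show ?case by (cases "a = b") auto
next
  case (Suc d)
  then have ab: "a < b" by auto
  define R where "R = {i \<in> {a+1..<b}. f i > f (i + 1)}"
  have "{i \<in> {a..<b}. f i > f (i + 1)} = (if f a > f (a + 1) then insert a R else R)"
    using ab by (auto simp: R_def order.order_iff_strict)
  moreover have "finite R" "a \<notin> R"
    unfolding R_def by (rule finite_subset[of _ "{a+1..<b}"]) auto
  ultimately have "card {i \<in> {a..<b}. f i > f (i + 1)} = of_bool (f a > f (a + 1)) + card R"
    by simp
  moreover have "descents (map f [a+1..b]) = card R"
    unfolding R_def using Suc by simp
  moreover have "[a..b] = a # (a+1) # [a+1+1..b]"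
    using ab upto_rec1[of a b] upto_rec1[of "a+1" b] by simp
  moreover have "[a+1..b] = (a+1) # [a+1+1..b]"
    using ab upto_rec1[of "a+1" b] by simp
  ultimately show ?case by simp
qed

lemma negs_map_upto:
  "negs (map f [a..b]) = card {i \<in> {a..b}. f i < 0}"
proof -
  have "negs (map f [a..b]) = length (filter (\<lambda>i. f i < 0) [a..b])"
    by (simp add: negs_def filter_map comp_def)
  also have "\<dots> = card (set (filter (\<lambda>i. f i < 0) [a..b]))"
    by (rule distinct_card[symmetric]) simp
  finally show ?thesis by simp
qed

subsection \<open>Signed permutations as words\<close>

text \<open>By oddness and injectivity, equal absolute values at \<open>i\<close> and
  \<open>j\<close> force \<open>i = j\<close> or \<open>i = - j\<close>, and the latter is
  impossible for positive positions; finiteness then gives surjectivity. This makes pi_1 ... pi_n a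
  signed word.\<close>

lemma signed_perms_abs_bij:
  assumes "\<pi> \<in> signed_perms n"
  shows "inj_on (\<lambda>i. \<bar>\<pi> i\<bar>) {1..int n}" and "(\<lambda>i. \<bar>\<pi> i\<bar>) ` {1..int n} = {1..int n}"
    and "\<pi> 0 = 0"
proof -
  have p: "\<pi> permutes {- int n..int n}" and odd: "\<And>i. i \<in> {- int n..int n} \<Longrightarrow> \<pi> (- i) = - \<pi> i"
    using assms by (auto simp: signed_perms_def)
  have inj: "\<pi> i = \<pi> j \<longleftrightarrow> i = j" for i j
    using permutes_inj[OF p] by (auto dest: injD)
  show z: "\<pi> 0 = 0" using odd[of 0] by simp
  show ij: "inj_on (\<lambda>i. \<bar>\<pi> i\<bar>) {1..int n}"
  proof (rule inj_onI)
    fix i j assume ij: "i \<in> {1..int n}" "j \<in> {1..int n}" "\<bar>\<pi> i\<bar> = \<bar>\<pi> j\<bar>"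
    then have "\<pi> i = \<pi> j \<or> \<pi> i = \<pi> (- j)" using odd[of j] by (auto simp: abs_eq_iff)
    then show "i = j" using inj ij by auto
  qed
  have "(\<lambda>i. \<bar>\<pi> i\<bar>) ` {1..int n} \<subseteq> {1..int n}"
  proof
    fix x assume "x \<in> (\<lambda>i. \<bar>\<pi> i\<bar>) ` {1..int n}"
    then obtain i where i: "i \<in> {1..int n}" "x = \<bar>\<pi> i\<bar>" by auto
    then have "\<pi> i \<in> {- int n..int n}" using permutes_in_image[OF p, of i] by auto
    moreover have "\<pi> i \<noteq> 0" using inj[of i 0] z i by auto
    ultimately show "x \<in> {1..int n}" using i by auto
  qed
  then show "(\<lambda>i. \<bar>\<pi> i\<bar>) ` {1..int n} = {1..int n}"
    using ij by (intro endo_inj_surj) auto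
qed

text \<open>The odd extension of a word, with letter \<open>i\<close> stored at list index
  \<open>i - 1\<close>. Outside the range it is the identity, as \<open>permutes\<close> demands,
  and it fixes 0.\<close>

definition perm_of_word :: "int list \<Rightarrow> int \<Rightarrow> int" where
  "perm_of_word w i =
     (if 1 \<le> i \<and> i \<le> int (length w) then w ! nat (i - 1)
      else if - int (length w) \<le> i \<and> i \<le> -1 then - (w ! nat (- i - 1)) else i)"

text \<open>The absolute value at \<open>i\<close> depends only on that of \<open>i\<close>, and
  distinct letters differ in absolute value. Equal values therefore give \<open>i = j\<close> or
  \<open>i = - j\<close>, and the second option with \<open>i\<close> different from
  \<open>j\<close> would make a nonzero value equal to its own negative.\<close>

lemma perm_of_word_in_signed_perms:
  assumes "w \<in> signed_words {1..int n}"
  shows "perm_of_word w \<in> signed_perms n"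
proof -
  have len: "length w = n" using length_signed_word[OF assms] by simp
  have d: "distinct (map abs w)" and s: "abs ` set w = {1..int n}"
    using assms by (auto simp: signed_words_def)
  have nz: "\<bar>w ! k\<bar> \<in> {1..int n}" if "k < n" for k
    using s len that by (metis imageI nth_mem)
  have inj: "k = l" if "k < n" "l < n" "\<bar>w ! k\<bar> = \<bar>w ! l\<bar>" for k l
    using d that len by (auto simp: distinct_conv_nth)
  have odd: "perm_of_word w (- i) = - perm_of_word w i" for i
    by (auto simp: perm_of_word_def)
  have abs: "\<bar>perm_of_word w i\<bar> = \<bar>w ! nat (\<bar>i\<bar> - 1)\<bar>" if "i \<in> {- int n..int n}" "i \<noteq> 0" for i
    using that by (auto simp: perm_of_word_def len abs_if)
  have z: "perm_of_word w 0 = 0" by (simp add: perm_of_word_def)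
  have nz': "\<bar>perm_of_word w i\<bar> \<in> {1..int n}" if "i \<in> {- int n..int n}" "i \<noteq> 0" for i
    using abs[OF that] nz[of "nat (\<bar>i\<bar> - 1)"] that by auto
  have "perm_of_word w permutes {- int n..int n}"
  proof (rule inj_imp_permutes)
    show "inj_on (perm_of_word w) {- int n..int n}"
    proof (rule inj_onI)
      fix i j assume i: "i \<in> {- int n..int n}" and j: "j \<in> {- int n..int n}"
        and e: "perm_of_word w i = perm_of_word w j"
      show "i = j"
      proof (cases "i = 0 \<or> j = 0")
        case True
        then show ?thesis using nz'[OF i] nz'[OF j] e z by (cases "i = 0"; cases "j = 0") auto
      next
        case False
        then have "\<bar>w ! nat (\<bar>i\<bar> - 1)\<bar> = \<bar>w ! nat (\<bar>j\<bar> - 1)\<bar>" using abs i j e by metis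
        then have "nat (\<bar>i\<bar> - 1) = nat (\<bar>j\<bar> - 1)" using i j False by (intro inj) auto
        then have "\<bar>i\<bar> = \<bar>j\<bar>" using False by auto
        then have "i = j \<or> i = - j" by (auto simp: abs_eq_iff)
        moreover have "perm_of_word w j \<noteq> - perm_of_word w j"
          using nz'[OF j] False by auto
        ultimately show ?thesis using e odd[of j] by auto
      qed
    qed
    show "perm_of_word w i \<in> {- int n..int n}" if "i \<in> {- int n..int n}" for i
      using nz'[OF that] that z by (cases "i = 0") auto
    show "perm_of_word w i = i" if "i \<notin> {- int n..int n}" for i
      using that by (auto simp: perm_of_word_def len)
  qed simp
  then show ?thesis using odd by (simp add: signed_perms_def)
qed

text \<open>Restriction to the positive positions and odd extension are mutually inverse, so any
  statistic that depends only on pi_1 ... pi_n can be summed over words.\<close>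

lemma sum_signed_perms:
  "(\<Sum>\<pi>\<in>signed_perms n. f (map \<pi> [1..int n])) = (\<Sum>w\<in>signed_words {1..int n}. f w)"
proof (rule sum.reindex_bij_witness[where i = perm_of_word and j = "\<lambda>\<pi>. map \<pi> [1..int n]"])
  fix \<pi> assume \<pi>: "\<pi> \<in> signed_perms n"
  then have p: "\<pi> permutes {- int n..int n}" and odd: "\<And>i. i \<in> {- int n..int n} \<Longrightarrow> \<pi> (- i) = - \<pi> i"
    by (auto simp: signed_perms_def)
  show "map \<pi> [1..int n] \<in> signed_words {1..int n}"
    using signed_perms_abs_bij(1,2)[OF \<pi>]
    by (simp add: signed_words_def distinct_map[of "\<lambda>i. \<bar>\<pi> i\<bar>"] comp_def image_image)
  show "perm_of_word (map \<pi> [1..int n]) = \<pi>"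
  proof
    fix i
    consider "1 \<le> i" "i \<le> int n" | "- int n \<le> i" "i \<le> -1" | "i = 0" | "i \<notin> {- int n..int n}"
      by force
    then show "perm_of_word (map \<pi> [1..int n]) i = \<pi> i"
    proof cases
      case 2
      then show ?thesis using odd[of i] by (auto simp: perm_of_word_def nth_upto)
    next
      case 4
      then show ?thesis using permutes_not_in[OF p] by (auto simp: perm_of_word_def)
    qed (auto simp: perm_of_word_def nth_upto signed_perms_abs_bij(3)[OF \<pi>])
  qed
next
  fix w assume w: "w \<in> signed_words {1..int n}"
  then show "perm_of_word w \<in> signed_perms n" by (rule perm_of_word_in_signed_perms)
  have "length w = n" using length_signed_word[OF w] by simp
  then have "map (perm_of_word w) [1..int n] ! k = w ! k" if "k < n" for k
    using that by (simp add: perm_of_word_def)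
  then show "map (perm_of_word w) [1..int n] = w"
    using \<open>length w = n\<close> by (intro nth_equalityI) simp_all
qed (rule refl)

lemma neg_eq_negs: "neg n \<pi> = negs (map \<pi> [1..int n])"
  unfolding neg_def negs_map_upto ..

lemma desB_eq_descents:
  assumes "\<pi> \<in> signed_perms n"
  shows "desB n \<pi> = descents (0 # map \<pi> [1..int n])"
proof -
  have "0 # map \<pi> [1..int n] = map \<pi> [0..int n]"
    using upto_rec1[of 0 "int n"] signed_perms_abs_bij(3)[OF assms] by simp
  then show ?thesis by (simp add: desB_def descents_map_upto)
qed

lemma B_poly_eq_sum_words:
  "B_poly n y s = (\<Sum>w\<in>signed_words {1..int n}. y ^ negs w * s ^ descents (0 # w))"
proof -
  have "B_poly n y s = (\<Sum>\<pi>\<in>signed_perms n. y ^ negs (map \<pi> [1..int n]) * s ^ descents (0 # map \<pi> [1..int n]))"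
    unfolding B_poly_def by (rule sum.cong) (simp_all only: neg_eq_negs desB_eq_descents)
  also have "\<dots> = (\<Sum>w\<in>signed_words {1..int n}. y ^ negs w * s ^ descents (0 # w))"
    by (rule sum_signed_perms)
  finally show ?thesis .
qed

subsection \<open>Invariance under relabelling of the alphabet\<close>

text \<open>Replacing each positive letter by its rank in \<open>K\<close>, and extending oddly to
  negative letters, preserves both order and sign, hence descents and negative letters. So the sum
  depends only on the size of \<open>K\<close>.\<close>

lemma A_poly_eq_sum_alphabet:
  assumes "finite K" "\<And>k. k \<in> K \<Longrightarrow> k > 0"
  shows "(\<Sum>w\<in>signed_words K. y ^ negs w * tail_weight s w) = A_poly (card K) y s"
proof -
  define rank where "rank x = int (card {k \<in> K. k \<le> x})" for x
  have rank_mono: "rank x < rank x'" if "x \<in> K" "x' \<in> K" "x < x'" for x x'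
  proof -
    have "{k \<in> K. k \<le> x} \<subseteq> {k \<in> K. k \<le> x'}" using that by auto
    moreover have "x' \<in> {k \<in> K. k \<le> x'}" "x' \<notin> {k \<in> K. k \<le> x}" using that by auto
    ultimately have "{k \<in> K. k \<le> x} \<subset> {k \<in> K. k \<le> x'}" by blast
    then show ?thesis unfolding rank_def using assms(1) by (simp add: psubset_card_mono)
  qed
  have rank_inj: "inj_on rank K"
    by (rule linorder_inj_onI') (metis rank_mono less_irrefl)
  have rank_range: "rank x \<in> {1..int (card K)}" if "x \<in> K" for x
  proof -
    have "{k \<in> K. k \<le> x} \<noteq> {}" using that by auto
    then have "card {k \<in> K. k \<le> x} > 0" using assms(1) by (simp add: card_gt_0_iff)
    moreover have "card {k \<in> K. k \<le> x} \<le> card K" using assms(1) by (intro card_mono) auto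
    ultimately show ?thesis by (simp add: rank_def)
  qed
  have rank_image: "rank ` K = {1..int (card K)}"
  proof (rule card_subset_eq)
    show "rank ` K \<subseteq> {1..int (card K)}" using rank_range by auto
    show "card (rank ` K) = card {1..int (card K)}" using card_image[OF rank_inj] by simp
  qed simp
  define unrank where "unrank = inv_into K rank"
  have unrank: "unrank j \<in> K" "rank (unrank j) = j" if "j \<in> {1..int (card K)}" for j
    using that rank_image by (auto simp: unrank_def inv_into_into f_inv_into_f)
  have unrank_rank: "unrank (rank x) = x" if "x \<in> K" for x
    using that rank_inj by (simp add: unrank_def)
  \<comment> \<open>The odd extensions of the rank map and of its inverse; \<open>sgn\<close>
    carries the sign of the letter.\<close>
  define up where "up x = sgn x * unrank \<bar>x\<bar>" for x
  define down where "down x = sgn x * rank \<bar>x\<bar>" for x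
  have abs_up: "\<bar>up x\<bar> = unrank \<bar>x\<bar>" "sgn (up x) = sgn x" if "\<bar>x\<bar> \<in> {1..int (card K)}" for x
    using assms(2)[OF unrank(1)[OF that]] that by (auto simp: up_def abs_mult sgn_mult abs_sgn_eq)
  have abs_down: "\<bar>down x\<bar> = rank \<bar>x\<bar>" "sgn (down x) = sgn x" if "\<bar>x\<bar> \<in> K" for x
    using rank_range[OF that] assms(2)[OF that]
    by (auto simp: down_def abs_mult sgn_mult abs_sgn_eq)
  have down_up: "down (up x) = x" if "\<bar>x\<bar> \<in> {1..int (card K)}" for x
    using abs_up[OF that] unrank[OF that] by (simp add: down_def sgn_mult_abs)
  have up_down: "up (down x) = x" if "\<bar>x\<bar> \<in> K" for x
    using abs_down[OF that] unrank_rank[OF that] by (simp add: up_def sgn_mult_abs)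
  have down_less: "down x < down x'" if "\<bar>x\<bar> \<in> K" "\<bar>x'\<bar> \<in> K" "x < x'" for x x'
  proof -
    \<comment> \<open>On two negative letters, monotonicity follows from that of \<open>rank\<close>
      applied to the negated letters in reversed order; for opposite signs, positivity of ranks
      suffices.\<close>
    have "x \<noteq> 0" "x' \<noteq> 0" using assms(2) that by force+
    then have "x > 0 \<and> x' > 0 \<or> x < 0 \<and> x' > 0 \<or> x < 0 \<and> x' < 0"
      using that by linarith
    then consider "x > 0" "x' > 0" | "x < 0" "x' > 0" | "x < 0" "x' < 0"
      by blast
    then show ?thesis
      using that rank_mono[of x x'] rank_mono[of "-x'" "-x"]
        rank_range[of "-x"] rank_range[of x']
      by cases (auto simp: down_def)
  qed
  have down_mono: "down x < down x' \<longleftrightarrow> x < x'" if "\<bar>x\<bar> \<in> K" "\<bar>x'\<bar> \<in> K" for x x'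
    using down_less that by (metis less_asym linorder_less_linear)
  have "(\<Sum>w\<in>signed_words K. y ^ negs w * tail_weight s w) =
      (\<Sum>w\<in>signed_words {1..int (card K)}. y ^ negs w * tail_weight s w)"
  proof (rule sum.reindex_bij_witness[where i = "map up" and j = "map down"])
    fix w assume w: "w \<in> signed_words K"
    then have K: "\<bar>x\<bar> \<in> K" if "x \<in> set w" for x
      using that by (auto simp: signed_words_def)
    show "map up (map down w) = w" using K up_down by (auto intro: map_idI)
    have "map abs (map down w) = map rank (map abs w)" using K abs_down by auto
    moreover have "distinct (map rank (map abs w))"
      using w rank_inj by (subst distinct_map) (auto simp: signed_words_def)
    moreover have "set (map rank (map abs w)) = {1..int (card K)}"
      using w rank_image by (auto simp: signed_words_def)
    ultimately show "map down w \<in> signed_words {1..int (card K)}"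
      unfolding signed_words_def by (metis (mono_tags, lifting) mem_Collect_eq set_map)
    have "descents (map down w) = descents w"
      using K down_mono by (intro descents_map) auto
    moreover have "down x < 0 \<longleftrightarrow> x < 0" if "x \<in> set w" for x
      using abs_down(2)[OF K[OF that]] by (metis sgn_less)
    then have "negs (map down w) = negs w" by (intro negs_map) auto
    ultimately show "y ^ negs (map down w) * tail_weight s (map down w) = y ^ negs w * tail_weight s w"
      by (simp add: tail_weight_def)
  next
    fix w assume w: "w \<in> signed_words {1..int (card K)}"
    then have K: "\<bar>x\<bar> \<in> {1..int (card K)}" if "x \<in> set w" for x
      using that unfolding signed_words_def by blast
    show "map down (map up w) = w" using K down_up by (auto intro: map_idI)
    have e: "map abs (map up w) = map unrank (map abs w)" using K abs_up by auto
    have u: "bij_betw unrank {1..int (card K)} K"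
      unfolding unrank_def using rank_inj rank_image
      by (intro bij_betw_inv_into) (auto simp: bij_betw_def)
    have "distinct (map unrank (map abs w))"
      using w u by (subst distinct_map) (auto simp: signed_words_def bij_betw_def)
    moreover have "set (map unrank (map abs w)) = K"
      using w u unfolding signed_words_def bij_betw_def set_map by simp
    ultimately show "map up w \<in> signed_words K"
      using e unfolding signed_words_def by (metis (mono_tags, lifting) mem_Collect_eq set_map)
  qed
  then show ?thesis by (simp add: A_poly_def)
qed

subsection \<open>Marking an initial run of ascents\<close>

text \<open>Here \<open>m\<close> is the length of the initial run of marked ascents. In the
  induction the term \<open>m = 0\<close> is the tail weight of the whole word, which is all that
  survives at a descent; at an ascent the other terms carry a factor \<open>1 - s\<close>, and
  \<open>s + (1 - s) = 1\<close>. The induction needs an arbitrary first letter \<open>a\<close>,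
  although only \<open>a = 0\<close> is used later.\<close>

lemma descents_marked_prefix:
  fixes s :: "'a::comm_ring_1"
  shows "s ^ descents (a # w) =
    (\<Sum>m\<le>length w. if sorted (a # take m w) then (1 - s) ^ m * tail_weight s (drop m w) else 0)"
proof (induction w arbitrary: a)
  case Nil
  then show ?case by (simp add: tail_weight_def)
next
  case (Cons x w)
  have "(\<Sum>m\<le>length (x # w).
      if sorted (a # take m (x # w)) then (1 - s) ^ m * tail_weight s (drop m (x # w)) else 0) =
    tail_weight s (x # w) + (\<Sum>m\<le>length w.
      if a \<le> x \<and> sorted (x # take m w) then (1 - s) ^ Suc m * tail_weight s (drop m w) else 0)"
    \<comment> \<open>The term \<open>m = 0\<close> is split off and the remaining indices are
      shifted by one.\<close>
    by (simp only: length_Cons sum.atMost_Suc_shift take_Suc_Cons drop_Suc_Cons sorted2) simp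
  also have "(\<Sum>m\<le>length w.
      if a \<le> x \<and> sorted (x # take m w) then (1 - s) ^ Suc m * tail_weight s (drop m w) else 0) =
    (if a \<le> x then (1 - s) * s ^ descents (x # w) else 0)"
    unfolding Cons.IH by (auto simp: sum_distrib_left mult.assoc intro!: sum.cong)
  also have "tail_weight s (x # w) + \<dots> = s ^ descents (a # x # w)"
    by (auto simp: tail_weight_def algebra_simps)
  finally show ?case by simp
qed

text \<open>After expanding each descent weight over marked prefixes, a pair of a word and a prefix
  length is the same as a subset \<open>U\<close> of the letters, namely the prefix, and a signed
  word on the complement. An increasing prefix is determined by its set of letters.\<close>

lemma B_poly_eq_sum_A_poly:
  fixes y s :: "'a::comm_ring_1"
  shows "B_poly n y s = (\<Sum>k\<le>n. of_nat (n choose k) * (1 - s) ^ (n - k) * A_poly k y s)"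
proof -
  let ?N = "{1..int n}"
  let ?P = "SIGMA w:signed_words ?N. {m. m \<le> n \<and> sorted (0 # take m w)}"
  let ?Q = "SIGMA U:Pow ?N. signed_words (?N - U)"
  have "B_poly n y s = (\<Sum>w\<in>signed_words ?N. \<Sum>m | m \<le> n \<and> sorted (0 # take m w).
      y ^ negs w * ((1 - s) ^ m * tail_weight s (drop m w)))"
    unfolding B_poly_eq_sum_words
  proof (rule sum.cong)
    fix w assume "w \<in> signed_words ?N"
    then have "length w = n" using length_signed_word by force
    moreover have "{m. m \<le> n \<and> sorted (0 # take m w)} = {m \<in> {..n}. sorted (0 # take m w)}"
      by auto
    ultimately show "y ^ negs w * s ^ descents (0 # w) =
      (\<Sum>m | m \<le> n \<and> sorted (0 # take m w). y ^ negs w * ((1 - s) ^ m * tail_weight s (drop m w)))"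
      by (simp only: descents_marked_prefix sum_distrib_left[symmetric] sum.inter_filter[OF finite_atMost])
  qed simp
  also have "\<dots> = (\<Sum>(w, m)\<in>?P. y ^ negs w * ((1 - s) ^ m * tail_weight s (drop m w)))"
    by (rule sum.Sigma) (auto simp: finite_signed_words)
  also have "\<dots> = (\<Sum>(U, v)\<in>?Q. y ^ negs v * ((1 - s) ^ card U * tail_weight s v))"
  proof (rule sum.reindex_bij_witness[where
        i = "\<lambda>(U, v). (sorted_list_of_set U @ v, card U)" and
        j = "\<lambda>(w, m). (set (take m w), drop m w)"])
    fix p assume "p \<in> ?P"
    then obtain w m where p: "p = (w, m)" and w: "w \<in> signed_words ?N" and m: "m \<le> n"
      and so: "sorted (0 # take m w)" by auto
    have len: "length w = n" using length_signed_word[OF w] by simp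
    \<comment> \<open>Sortedness after the leading 0 rules out negative letters in the prefix. Hence
      the prefix uses letters of the alphabet unchanged, and all negative letters of
      \<open>w\<close> lie in the rest.\<close>
    have pos: "\<forall>x\<in>set (take m w). 0 \<le> x" using so by simp
    have abs: "map abs (take m w) = take m w" using pos by (intro map_idI) auto
    have d: "distinct (take m w @ map abs (drop m w))"
      using w abs unfolding signed_words_def
      by (metis (mono_tags, lifting) append_take_drop_id map_append mem_Collect_eq)
    have st: "set (take m w @ map abs (drop m w)) = ?N"
      using w abs unfolding signed_words_def
      by (metis (mono_tags, lifting) append_take_drop_id map_append mem_Collect_eq set_map)
    have c: "card (set (take m w)) = m"
      using d distinct_card[of "take m w"] len m by simp
    have sl: "sorted_list_of_set (set (take m w)) = take m w"
      using d so by (intro sorted_distinct_set_unique) auto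
    show "(case (case p of (w, m) \<Rightarrow> (set (take m w), drop m w)) of
        (U, v) \<Rightarrow> (sorted_list_of_set U @ v, card U)) = p"
      using c sl by (simp add: p)
    have "set (map abs (drop m w)) = ?N - set (take m w)" using d st by auto
    then show "(case p of (w, m) \<Rightarrow> (set (take m w), drop m w)) \<in> ?Q"
      using d st by (auto simp: p signed_words_def)
    have "filter (\<lambda>x. x < 0) (take m w) = []" using pos by (auto simp: filter_empty_conv)
    then have "negs w = negs (drop m w)"
      unfolding negs_def by (metis append_take_drop_id filter_append self_append_conv2)
    then show "(case (case p of (w, m) \<Rightarrow> (set (take m w), drop m w)) of
        (U, v) \<Rightarrow> y ^ negs v * ((1 - s) ^ card U * tail_weight s v)) =
      (case p of (w, m) \<Rightarrow> y ^ negs w * ((1 - s) ^ m * tail_weight s (drop m w)))"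
      using c by (simp add: p)
  next
    fix q assume "q \<in> ?Q"
    then obtain U v where q: "q = (U, v)" and U: "U \<subseteq> ?N" and v: "v \<in> signed_words (?N - U)"
      by auto
    have fin: "finite U" using U finite_subset by blast
    show "(case (case q of (U, v) \<Rightarrow> (sorted_list_of_set U @ v, card U)) of
        (w, m) \<Rightarrow> (set (take m w), drop m w)) = q"
      using fin by (simp add: q)
    have "card U \<le> n" using card_mono[OF _ U] by simp
    moreover have "sorted_list_of_set U @ v \<in> signed_words ?N"
    proof -
      have "map abs (sorted_list_of_set U) = sorted_list_of_set U"
        using U fin by (intro map_idI) auto
      moreover from this have "abs ` U = U"
        using fin by (metis set_map set_sorted_list_of_set)
      ultimately show ?thesis
        using U v fin by (auto simp: signed_words_def image_Un)
    qed
    moreover have "sorted (0 # sorted_list_of_set U)" using U fin by auto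
    ultimately show "(case q of (U, v) \<Rightarrow> (sorted_list_of_set U @ v, card U)) \<in> ?P"
      by (simp add: q)
  qed
  also have "\<dots> = (\<Sum>U\<in>Pow ?N. \<Sum>v\<in>signed_words (?N - U). y ^ negs v * ((1 - s) ^ card U * tail_weight s v))"
    by (rule sum.Sigma[symmetric]) (auto simp: finite_signed_words)
  \<comment> \<open>By relabelling, the inner sum depends only on the size of the complement of
    \<open>U\<close>; the subsets can then be grouped by cardinality, which produces the binomial
    coefficients.\<close>
  also have "\<dots> = (\<Sum>U\<in>Pow ?N. (1 - s) ^ card U * A_poly (n - card U) y s)"
  proof (rule sum.cong)
    fix U assume "U \<in> Pow ?N"
    then have "card (?N - U) = n - card U" by (auto simp: card_Diff_subset finite_subset)
    then have "A_poly (n - card U) y s = (\<Sum>v\<in>signed_words (?N - U). y ^ negs v * tail_weight s v)"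
      using A_poly_eq_sum_alphabet[of "?N - U" y s] by simp
    then show "(\<Sum>v\<in>signed_words (?N - U). y ^ negs v * ((1 - s) ^ card U * tail_weight s v)) =
        (1 - s) ^ card U * A_poly (n - card U) y s"
      by (simp add: sum_distrib_left mult_ac)
  qed simp
  also have "\<dots> = (\<Sum>k\<le>n. \<Sum>U | U \<in> Pow ?N \<and> card U = k. (1 - s) ^ card U * A_poly (n - card U) y s)"
  proof (rule sum.group[symmetric])
    have "card U \<le> n" if "U \<subseteq> ?N" for U
      using card_mono[OF _ that] by simp
    then show "card ` Pow ?N \<subseteq> {..n}" by blast
  qed simp_all
  also have "\<dots> = (\<Sum>k\<le>n. of_nat (n choose k) * (1 - s) ^ k * A_poly (n - k) y s)"
  proof (rule sum.cong)
    fix k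
    have "(\<Sum>U | U \<in> Pow ?N \<and> card U = k. (1 - s) ^ card U * A_poly (n - card U) y s) =
        (\<Sum>U | U \<subseteq> ?N \<and> card U = k. (1 - s) ^ k * A_poly (n - k) y s)"
      by (intro sum.cong) auto
    then show "(\<Sum>U | U \<in> Pow ?N \<and> card U = k. (1 - s) ^ card U * A_poly (n - card U) y s) =
        of_nat (n choose k) * (1 - s) ^ k * A_poly (n - k) y s"
      using n_subsets[of ?N k] by (simp add: mult.assoc)
  qed simp
  also have "\<dots> = (\<Sum>k\<le>n. of_nat (n choose k) * (1 - s) ^ (n - k) * A_poly k y s)"
    by (rule sum.reindex_bij_witness[where i = "\<lambda>k. n - k" and j = "\<lambda>k. n - k"])
      (auto simp: binomial_symmetric[symmetric])
  finally show ?thesis .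
qed

subsection \<open>Binomial inversion\<close>

text \<open>Substituting the hypothesis and using (n choose k)(k choose j) = (n choose j)(n-j choose
  k-j), the coefficient of \<open>a j\<close> becomes (n choose j) times the binomial expansion of
  \<open>(c + - c) ^ (n - j)\<close>, which is 1 for \<open>j = n\<close> and 0 for smaller
  \<open>j\<close>.\<close>

lemma binomial_inversion:
  fixes a b :: "nat \<Rightarrow> 'a::comm_ring_1"
  assumes "\<And>n. b n = (\<Sum>k\<le>n. of_nat (n choose k) * c ^ (n - k) * a k)"
  shows "a n = (\<Sum>k\<le>n. of_nat (n choose k) * (- c) ^ (n - k) * b k)"
proof -
  have inner: "(\<Sum>k\<le>n. of_nat (n choose k) * of_nat (k choose j) * (- c) ^ (n - k) * c ^ (k - j)) =
      of_nat (n choose j) * 0 ^ (n - j)" if "j \<le> n" for j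
  proof -
    have "(\<Sum>k\<le>n. of_nat (n choose k) * of_nat (k choose j) * (- c) ^ (n - k) * c ^ (k - j)) =
        (\<Sum>k\<in>{j..n}. of_nat (n choose k) * of_nat (k choose j) * (- c) ^ (n - k) * c ^ (k - j))"
      by (rule sum.mono_neutral_right) (auto simp: not_le binomial_eq_0)
    also have "\<dots> = (\<Sum>i\<le>n - j. of_nat (n choose j) * (of_nat ((n - j) choose i) * c ^ i * (- c) ^ (n - j - i)))"
    proof (rule sum.reindex_bij_witness[where i = "\<lambda>i. i + j" and j = "\<lambda>k. k - j"])
      fix k assume k: "k \<in> {j..n}"
      then have "(n choose k) * (k choose j) = (n choose j) * ((n - j) choose (k - j))"
        by (intro choose_mult) auto
      then have "of_nat (n choose k) * of_nat (k choose j) =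
          (of_nat (n choose j) * of_nat ((n - j) choose (k - j)) :: 'a)"
        by (metis of_nat_mult)
      then show "of_nat (n choose j) * (of_nat ((n - j) choose (k - j)) * c ^ (k - j) * (- c) ^ (n - j - (k - j))) =
          of_nat (n choose k) * of_nat (k choose j) * (- c) ^ (n - k) * c ^ (k - j)"
        using k by (simp add: mult_ac)
    qed (use that in auto)
    also have "\<dots> = of_nat (n choose j) * (c + - c) ^ (n - j)"
      by (simp only: binomial_ring sum_distrib_left)
    finally show ?thesis by simp
  qed
  have "(\<Sum>k\<le>n. of_nat (n choose k) * (- c) ^ (n - k) * b k) =
      (\<Sum>k\<le>n. \<Sum>j\<le>n. of_nat (n choose k) * of_nat (k choose j) * (- c) ^ (n - k) * c ^ (k - j) * a j)"
  proof (rule sum.cong)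
    fix k assume "k \<in> {..n}"
    \<comment> \<open>Extending the range from \<open>k\<close> to \<open>n\<close> adds only terms
      with \<open>k choose j = 0\<close> and makes the order of summation exchangeable.\<close>
    then have "b k = (\<Sum>j\<le>n. of_nat (k choose j) * c ^ (k - j) * a j)"
      unfolding assms by (intro sum.mono_neutral_left) (auto simp: not_le binomial_eq_0)
    then show "of_nat (n choose k) * (- c) ^ (n - k) * b k =
      (\<Sum>j\<le>n. of_nat (n choose k) * of_nat (k choose j) * (- c) ^ (n - k) * c ^ (k - j) * a j)"
      by (simp add: sum_distrib_left mult_ac)
  qed simp
  also have "\<dots> = (\<Sum>j\<le>n. (\<Sum>k\<le>n. of_nat (n choose k) * of_nat (k choose j) * (- c) ^ (n - k) * c ^ (k - j)) * a j)"
    unfolding sum_distrib_right by (rule sum.swap)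
  also have "\<dots> = (\<Sum>j\<le>n. if j = n then a n else 0)"
    by (intro sum.cong) (auto simp: inner power_0_left)
  finally show ?thesis by simp
qed

lemma A_poly_eq_sum_B_poly:
  fixes y s :: "'a::comm_ring_1"
  shows "A_poly n y s =
    (\<Sum>k=0..n. (-1) ^ (n - k) * of_nat (n choose k) * (1 - s) ^ (n - k) * B_poly k y s)"
proof -
  have "A_poly n y s = (\<Sum>k\<le>n. of_nat (n choose k) * (- (1 - s)) ^ (n - k) * B_poly k y s)"
    by (rule binomial_inversion) (rule B_poly_eq_sum_A_poly)
  then show ?thesis
    unfolding atMost_atLeast0 power_minus[of "1 - s"] by (simp add: mult_ac)
qed

subsection \<open>Flag descents\<close>

text \<open>Multiplying by \<open>t * (1 + t)\<close> keeps the identity free of division, and it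
  holds for each permutation separately. With \<open>d\<close> descents inside the word, both sides
  are t^(2d+1) + t^(2d+2) if pi_1 > 0, and t^(2d+3) + t^(2d+2) if pi_1 < 0.\<close>

lemma F_poly_eq_B_poly_A_poly:
  fixes y t :: "'a::comm_ring_1"
  assumes "n \<ge> 1"
  shows "t * (1 + t) * F_poly n y t = t * B_poly n y (t\<^sup>2) + A_poly n y (t\<^sup>2)"
proof -
  have "t * (1 + t) * t ^ fdes n \<pi> = t * (t\<^sup>2) ^ desB n \<pi> + tail_weight (t\<^sup>2) (map \<pi> [1..int n])"
    if "\<pi> \<in> signed_perms n" for \<pi>
  proof -
    let ?d = "descents (map \<pi> [1..int n])"
    have w: "map \<pi> [1..int n] = \<pi> 1 # map \<pi> [2..int n]"
      using assms upto_rec1[of 1 "int n"] by simp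
    have "\<pi> 1 \<noteq> 0"
      using signed_perms_abs_bij(2)[OF that] assms by force
    moreover have "desB n \<pi> = of_bool (\<pi> 1 < 0) + ?d"
      using desB_eq_descents[OF that] by (simp add: w)
    ultimately consider "\<pi> 1 > 0" "desB n \<pi> = ?d" | "\<pi> 1 < 0" "desB n \<pi> = Suc ?d"
      by (cases "\<pi> 1 > 0") auto
    then show ?thesis
    proof cases
      case 1
      then have "t ^ fdes n \<pi> = (t\<^sup>2) ^ ?d"
        by (simp add: fdes_def power_mult)
      then show ?thesis
        using 1 w by (simp add: tail_weight_def algebra_simps power2_eq_square)
    next
      case 2
      \<comment> \<open>The descent at position 0 makes \<open>desB\<close> at least 1, so the
        subtraction in \<open>fdes\<close> is exact: 2(d+1) - 1 = 2d + 1.\<close>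
      then have "fdes n \<pi> = Suc (2 * ?d)"
        by (simp add: fdes_def)
      then have "t ^ fdes n \<pi> = t * (t\<^sup>2) ^ ?d"
        by (simp add: power_mult)
      then show ?thesis
        using 2 w by (simp add: tail_weight_def algebra_simps power2_eq_square)
    qed
  qed
  then have "t * (1 + t) * (y ^ neg n \<pi> * t ^ fdes n \<pi>) =
      y ^ neg n \<pi> * (t * (t\<^sup>2) ^ desB n \<pi> + tail_weight (t\<^sup>2) (map \<pi> [1..int n]))"
    if "\<pi> \<in> signed_perms n" for \<pi>
    using that by (metis mult.left_commute)
  then have "t * (1 + t) * F_poly n y t = (\<Sum>\<pi>\<in>signed_perms n.
      y ^ neg n \<pi> * (t * (t\<^sup>2) ^ desB n \<pi> + tail_weight (t\<^sup>2) (map \<pi> [1..int n])))"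
    unfolding F_poly_def sum_distrib_left by (intro sum.cong) simp_all
  also have "\<dots> = t * B_poly n y (t\<^sup>2) + A_poly n y (t\<^sup>2)"
    unfolding B_poly_def A_poly_def sum_signed_perms[symmetric]
    by (simp add: neg_eq_negs sum.distrib sum_distrib_left algebra_simps)
  finally show ?thesis .
qed

theorem theorem2p9:
  fixes n :: nat
  assumes "n \<ge> 1"
  shows "F_poly n Y T =
    1 / (1 + T) *
      (B_poly n Y (T\<^sup>2) +
       1 / T * (\<Sum>k=0..n. (-1) ^ (n - k) * of_nat (n choose k) * (1 - T\<^sup>2) ^ (n - k)
                          * B_poly k Y (T\<^sup>2)))"
proof -
  have "T \<noteq> 0" by (simp add: T_def)
  \<comment> \<open>Division by \<open>1 + T\<close> is legitimate because it is the image of a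
    nonzero polynomial in the fraction field.\<close>
  moreover have "1 + T = to_fract [:1, 1:]"
    by (simp add: T_def one_pCons flip: to_fract_1 to_fract_add)
  then have "1 + T \<noteq> 0" by simp
  ultimately have "F_poly n Y T = (T * B_poly n Y (T\<^sup>2) + A_poly n Y (T\<^sup>2)) / (T * (1 + T))"
    using F_poly_eq_B_poly_A_poly[OF assms, of T Y]
    by (simp add: nonzero_eq_divide_eq mult.commute)
  also have "\<dots> = 1 / (1 + T) * (B_poly n Y (T\<^sup>2) + 1 / T * A_poly n Y (T\<^sup>2))"
  proof -
    have "B_poly n Y (T\<^sup>2) + 1 / T * A_poly n Y (T\<^sup>2) = (T * B_poly n Y (T\<^sup>2) + A_poly n Y (T\<^sup>2)) / T"
      using \<open>T \<noteq> 0\<close> by (simp add: add_divide_distrib)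
    then show ?thesis by (simp only: times_divide_times_eq mult_1 mult.commute)
  qed
  finally show ?thesis unfolding A_poly_eq_sum_B_poly .
qed

end
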